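(* Let $k$ be a field, let $\mathfrak{h}$ be a Lie algebra over $k$, and let $\mathfrak{g}\subseteq\mathfrak{h}$ be a Lie subalgebra of codimension $1$ in $\mathfrak{h}$. Fix $x\in\mathfrak{h}\setminus\mathfrak{g}$ and let $(\lambda,\Delta)$ be the twisted derivation of $\mathfrak{g}$ determined by $x$, i.e. the linear maps $\lambda:\mathfrak{g}\to k$ and $\Delta:\mathfrak{g}\to\mathfrak{g}$ given by $[x,g]=\Delta(g)+\lambda(g)\,x$ for all $g\in\mathfrak{g}$. Then the map $$\Omega:\mathbb{G}_{\mathfrak{g}}(\lambda,\Delta)\to\mathrm{Gal}(\mathfrak{h}/\mathfrak{g}),\qquad\Omega(u,g_0)(g+\alpha x):=g+\alpha g_0+u\alpha x,$$ for all $(u,g_0)\in\mathbb{G}_{\mathfrak{g}}(\lambda,\Delta)$, $g\in\mathfrak{g}$ and $\alpha\in k$, is an isomorphism of groups. In particular, the Galois group $\mathrm{Gal}(\mathfrak{h}/\mathfrak{g})$ is metabelian and hence solvable.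
   Context: Galois group: $\mathrm{Gal}(\mathfrak{h}/\mathfrak{g}):=\{\sigma\in\mathrm{Aut}_{\mathrm{Lie}}(\mathfrak{h})\mid\sigma(g)=g\ \forall g\in\mathfrak{g}\}$. A twisted derivation of $\mathfrak{g}$ is a pair $(\lambda,\Delta)$ of linear maps $\lambda:\mathfrak{g}\to k$, $\Delta:\mathfrak{g}\to\mathfrak{g}$ such that for all $g,h\in\mathfrak{g}$: $\lambda([g,h])=0$ and $\Delta([g,h])=[\Delta(g),h]+[g,\Delta(h)]+\lambda(g)\Delta(h)-\lambda(h)\Delta(g)$. Since $\mathfrak{h}=\mathfrak{g}\oplus kx$, the pair determined by $[x,g]=\Delta(g)+\lambda(g)x$ is such a twisted derivation. $\mathbb{G}_{\mathfrak{g}}(\lambda,\Delta)$ is the set of all pairs $(u,g_0)\in k^*\times\mathfrak{g}$ such that $\lambda(g)\,g_0=[g_0,g]+(u-1)\Delta(g)$ for all $g\in\mathfrak{g}$. It is a subgroup of the group $k^*\rtimes\mathfrak{g}$, which is the set $k^*\times\mathfrak{g}$ with multiplication $(u,g)\cdot(u',g'):=(uu',\ u'g+g')$. A group is metabelian if its derived (commutator) subgroup is abelian. *)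

theory Defs
  imports Complex_Main "HOL-Algebra.Solvable_Groups"
begin

text \<open>The members of the family \<open>b 0, ..., b (n - 1)\<close> represent a basis of the quotient space
  \<open>V / W\<close>: the two conjuncts say that their cosets span \<open>V / W\<close> and are linearly independent there.\<close>

definition (in vector_space) has_codim :: "'b set \<Rightarrow> nat \<Rightarrow> bool" where
  "has_codim W n \<longleftrightarrow>
     (\<exists>b :: nat \<Rightarrow> 'b.
        (\<forall>v. \<exists>c. v - (\<Sum>i<n. c i *s b i) \<in> W) \<and>
        (\<forall>c. (\<Sum>i<n. c i *s b i) \<in> W \<longrightarrow> (\<forall>i<n. c i = 0)))"

locale lie_algebra = vector_space scale
  for scale :: "'k :: field \<Rightarrow> 'h :: ab_group_add \<Rightarrow> 'h" (infixr "*s" 75) +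
  fixes bracket :: "'h \<Rightarrow> 'h \<Rightarrow> 'h"
  assumes bracket_add_left: "bracket (a + b) c = bracket a c + bracket b c"
    and bracket_add_right: "bracket a (b + c) = bracket a b + bracket a c"
    and bracket_scale_left: "bracket (r *s a) b = r *s bracket a b"
    and bracket_scale_right: "bracket a (r *s b) = r *s bracket a b"
    and bracket_self: "bracket a a = 0"
    and jacobi: "bracket a (bracket b c) + bracket b (bracket c a) + bracket c (bracket a b) = 0"
begin

definition lie_subalgebra :: "'h set \<Rightarrow> bool" where
  "lie_subalgebra G \<longleftrightarrow> subspace G \<and> (\<forall>a\<in>G. \<forall>b\<in>G. bracket a b \<in> G)"

definition lie_automorphism :: "('h \<Rightarrow> 'h) \<Rightarrow> bool" where
  "lie_automorphism \<sigma> \<longleftrightarrow>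
     Vector_Spaces.linear scale scale \<sigma> \<and> bij \<sigma> \<and>
     (\<forall>a b. \<sigma> (bracket a b) = bracket (\<sigma> a) (\<sigma> b))"

definition lie_Aut :: "('h \<Rightarrow> 'h) monoid" where
  "lie_Aut = \<lparr>carrier = {\<sigma>. lie_automorphism \<sigma>}, monoid.mult = (\<lambda>\<sigma> \<tau>. \<sigma> \<circ> \<tau>), one = id\<rparr>"

definition Gal :: "'h set \<Rightarrow> ('h \<Rightarrow> 'h) monoid" where
  "Gal G = lie_Aut\<lparr>carrier := {\<sigma> \<in> carrier lie_Aut. \<forall>g\<in>G. \<sigma> g = g}\<rparr>"

text \<open>Maps defined on the subalgebra \<open>G\<close> are represented by functions on the whole type; only
  their values on \<open>G\<close> are constrained or used.\<close>

definition twisted_derivation :: "'h set \<Rightarrow> ('h \<Rightarrow> 'k) \<Rightarrow> ('h \<Rightarrow> 'h) \<Rightarrow> bool" where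
  "twisted_derivation G l \<Delta> \<longleftrightarrow>
     \<Delta> \<in> G \<rightarrow> G \<and>
     (\<forall>g\<in>G. \<forall>h\<in>G. l (g + h) = l g + l h \<and> \<Delta> (g + h) = \<Delta> g + \<Delta> h) \<and>
     (\<forall>r. \<forall>g\<in>G. l (r *s g) = r * l g \<and> \<Delta> (r *s g) = r *s \<Delta> g) \<and>
     (\<forall>g\<in>G. \<forall>h\<in>G. l (bracket g h) = 0) \<and>
     (\<forall>g\<in>G. \<forall>h\<in>G.
        \<Delta> (bracket g h) = bracket (\<Delta> g) h + bracket g (\<Delta> h) + l g *s \<Delta> h - l h *s \<Delta> g)"

definition semidirect :: "'h set \<Rightarrow> ('k \<times> 'h) monoid" where
  "semidirect G =
     \<lparr>carrier = {u. u \<noteq> 0} \<times> G,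
      monoid.mult = (\<lambda>(u, g) (u', g'). (u * u', u' *s g + g')),
      one = (1, 0)\<rparr>"

definition GG :: "'h set \<Rightarrow> ('h \<Rightarrow> 'k) \<Rightarrow> ('h \<Rightarrow> 'h) \<Rightarrow> ('k \<times> 'h) monoid" where
  "GG G l \<Delta> = (semidirect G)
     \<lparr>carrier := {(u, g0) \<in> carrier (semidirect G).
                   \<forall>g\<in>G. l g *s g0 = bracket g0 g + (u - 1) *s \<Delta> g}\<rparr>"

text \<open>The description is well defined when \<open>G\<close> is a subspace of codimension one and \<open>x \<notin> G\<close>,
  since then every \<open>v\<close> is \<open>g + \<alpha> *s x\<close> for unique \<open>g \<in> G\<close> and \<open>\<alpha>\<close>.\<close>

definition Omega :: "'h set \<Rightarrow> 'h \<Rightarrow> 'k \<times> 'h \<Rightarrow> 'h \<Rightarrow> 'h" where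
  "Omega G x = (\<lambda>(u, g0) v.
     THE w. \<exists>g\<in>G. \<exists>\<alpha>. v = g + \<alpha> *s x \<and> w = g + \<alpha> *s g0 + (u * \<alpha>) *s x)"

lemma codim_1_decomp:
  assumes G: "subspace G" and "has_codim G 1" and x: "x \<notin> G"
  shows "\<exists>g\<in>G. \<exists>\<alpha>. v = g + \<alpha> *s x"
proof -
  from \<open>has_codim G 1\<close> obtain b where b: "\<And>v. \<exists>c. v - c *s b \<in> G"
    unfolding has_codim_def by (simp add: lessThan_Suc) blast
  obtain c a where c: "x - c *s b \<in> G" and a: "v - a *s b \<in> G"
    using b by blast
  have "c \<noteq> 0" using c x by auto
  then have "v - (a / c) *s x = (v - a *s b) - (a / c) *s (x - c *s b)"
    by (simp add: scale_right_diff_distrib)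
  also have "\<dots> \<in> G" by (intro subspace_diff[OF G] subspace_scale[OF G] a c)
  finally show ?thesis
    by (intro bexI[of _ "v - (a / c) *s x"] exI[of _ "a / c"]) simp_all
qed

text \<open>The pair \<open>(l, \<Delta>)\<close> determined by \<open>x\<close> always exists.\<close>

lemma determined_pair_exists:
  assumes "lie_subalgebra G" and "has_codim G 1" and "x \<notin> G"
  shows "\<exists>l \<Delta>. \<Delta> \<in> G \<rightarrow> G \<and> (\<forall>g\<in>G. bracket x g = \<Delta> g + l g *s x)"
proof -
  have "\<forall>g. \<exists>d a. d \<in> G \<and> bracket x g = d + a *s x"
    using codim_1_decomp[of G x] assms unfolding lie_subalgebra_def by blast
  then obtain \<Delta> l where "\<forall>g. \<Delta> g \<in> G \<and> bracket x g = \<Delta> g + l g *s x" by metis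
  then show ?thesis by blast
qed

end

definition metabelian :: "('a, 'm) monoid_scheme \<Rightarrow> bool" where
  "metabelian G \<longleftrightarrow> group G \<and> comm_group (G\<lparr>carrier := derived G (carrier G)\<rparr>)"

end

theory Submission
  imports Defs
begin

text \<open>An automorphism \<open>\<sigma>\<close> fixing \<open>G\<close> pointwise is determined by \<open>\<sigma> x = g0 + u *s x\<close>; injectivity
  forces \<open>u \<noteq> 0\<close>, and comparing \<open>\<sigma> [x, g]\<close> with \<open>[\<sigma> x, g]\<close> modulo \<open>x\<close> is precisely the equation that
  defines \<open>\<GG>\<close>. The projection \<open>(u, g0) \<mapsto> u\<close> is a homomorphism into the multiplicative group of the
  field whose kernel is the additive group of those \<open>g0\<close>, so \<open>\<GG>\<close> is metabelian.\<close>

section \<open>Metabelian groups\<close>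

text \<open>A homomorphism carries the derived subgroup onto the derived subgroup of its image, and
  this is trivial in an abelian group. So commutators lie in the kernel, where multiplication
  commutes.\<close>

lemma (in group_hom) metabelian_if_kernel_commutes:
  assumes "comm_group H"
    and comm: "\<And>a b. a \<in> kernel G H h \<Longrightarrow> b \<in> kernel G H h \<Longrightarrow> a \<otimes> b = b \<otimes> a"
  shows "metabelian G"
proof -
  let ?D = "derived G (carrier G)"
  have sub: "subgroup ?D G"
    by (simp add: G.derived_is_subgroup)
  have "h ` ?D = derived H (h ` carrier G)"
    by (simp add: derived_img)
  also have "\<dots> = {\<one>\<^bsub>H\<^esub>}"
    using \<open>comm_group H\<close> by (intro comm_group.derived_eq_singleton) auto
  finally have "?D \<subseteq> kernel G H h"
    using subgroup.subset[OF sub] by (auto simp: kernel_def)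
  then have "comm_group (G\<lparr>carrier := ?D\<rparr>)"
    by (intro group.group_comm_groupI[OF G.subgroup_imp_group[OF sub]]) (auto intro!: comm)
  then show ?thesis
    by (simp add: metabelian_def)
qed

text \<open>Surjectivity makes the derived subgroup of \<open>H\<close> the image of that of
  \<open>G\<close>, and an image of an abelian group is abelian. This carries the property along
  \<open>Omega\<close>.\<close>

lemma (in group_hom) metabelian_surj_img:
  assumes "metabelian G" and surj: "h ` carrier G = carrier H"
  shows "metabelian H"
proof -
  let ?D = "derived G (carrier G)"
  have D: "derived H (carrier H) = h ` ?D"
    using derived_img[of "carrier G"] surj by simp
  have sub: "subgroup ?D G"
    by (simp add: G.derived_is_subgroup)
  have comm: "a \<otimes> b = b \<otimes> a" if "a \<in> ?D" "b \<in> ?D" for a b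
    using comm_groupE(4)[of "G\<lparr>carrier := ?D\<rparr>" a b] that assms(1) by (simp add: metabelian_def)
  have "comm_group (H\<lparr>carrier := h ` ?D\<rparr>)"
  proof (rule group.group_comm_groupI)
    show "group (H\<lparr>carrier := h ` ?D\<rparr>)"
      by (intro H.subgroup_imp_group subgroup_img_is_subgroup sub)
    show "p \<otimes>\<^bsub>H\<lparr>carrier := h ` ?D\<rparr>\<^esub> q = q \<otimes>\<^bsub>H\<lparr>carrier := h ` ?D\<rparr>\<^esub> p"
      if pq: "p \<in> carrier (H\<lparr>carrier := h ` ?D\<rparr>)" "q \<in> carrier (H\<lparr>carrier := h ` ?D\<rparr>)" for p q
    proof -
      obtain a b where ab: "a \<in> ?D" "b \<in> ?D" "p = h a" "q = h b"
        using pq by auto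
      moreover have "a \<in> carrier G" "b \<in> carrier G"
        using ab subgroup.subset[OF sub] by auto
      ultimately show ?thesis
        using comm[of a b] by (simp flip: hom_mult)
    qed
  qed
  then show ?thesis
    by (simp add: metabelian_def D)
qed

lemma metabelian_imp_solvable:
  assumes "metabelian G"
  shows "solvable G"
proof -
  interpret group G
    using assms by (simp add: metabelian_def)
  let ?D = "derived G (carrier G)"
  have sub: "subgroup ?D G"
    by (simp add: derived_is_subgroup)
  have "derived (G\<lparr>carrier := ?D\<rparr>) ?D = {\<one>\<^bsub>G\<^esub>}"
    using comm_group.derived_eq_singleton[of "G\<lparr>carrier := ?D\<rparr>" ?D] assms
    by (simp add: metabelian_def)
  \<comment> \<open>\<open>derived_consistent\<close> identifies the derived subgroup formed inside
    \<open>?D\<close> with the one formed in \<open>G\<close>, so the derived series stops after two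
    steps.\<close>
  then have "(derived G ^^ 2) (carrier G) = {\<one>\<^bsub>G\<^esub>}"
    using derived_consistent[OF order.refl sub] by (simp add: numeral_2_eq_2)
  then show ?thesis
    unfolding solvable_iff_trivial_derived_seq by blast
qed

section \<open>The Galois group of a subalgebra of codimension one\<close>

context lie_algebra
begin

text \<open>Polarisation of \<open>bracket_self\<close> at \<open>a + b\<close>, valid in every
  characteristic.\<close>

lemma bracket_anticomm: "bracket a b = - bracket b a"
proof -
  have "bracket a b + bracket b a = bracket (a + b) a + bracket (a + b) b"
    by (simp add: bracket_add_left bracket_self)
  also have "\<dots> = 0"
    by (simp only: bracket_self flip: bracket_add_right)
  finally show ?thesis
    by (simp only: eq_neg_iff_add_eq_0)
qed

lemma bracket_zero_left [simp]: "bracket 0 a = 0"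
  using bracket_scale_left[of 0 0 a] by simp

lemma bracket_minus_left [simp]: "bracket (- a) b = - bracket a b"
  using bracket_scale_left[of "- 1" a b] by simp

lemma carrier_Gal: "carrier (Gal G) = {\<sigma>. lie_automorphism \<sigma> \<and> (\<forall>g\<in>G. \<sigma> g = g)}"
  by (simp add: Gal_def lie_Aut_def)

lemma mult_Gal [simp]: "\<sigma> \<otimes>\<^bsub>Gal G\<^esub> \<tau> = \<sigma> \<circ> \<tau>"
  by (simp add: Gal_def lie_Aut_def)

lemma one_Gal [simp]: "\<one>\<^bsub>Gal G\<^esub> = id"
  by (simp add: Gal_def lie_Aut_def)

lemma lie_automorphism_id: "lie_automorphism id"
  by (simp add: lie_automorphism_def linear_id)

lemma lie_automorphism_comp:
  "lie_automorphism \<sigma> \<Longrightarrow> lie_automorphism \<tau> \<Longrightarrow> lie_automorphism (\<sigma> \<circ> \<tau>)"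
  by (auto simp: lie_automorphism_def intro: Vector_Spaces.linear_compose bij_comp)

text \<open>Only the monoid laws are checked directly; inverses are obtained later by transport from
  \<open>GG\<close>.\<close>

lemma monoid_Gal: "monoid (Gal G)"
  by (rule monoidI) (auto simp: carrier_Gal lie_automorphism_id lie_automorphism_comp)

section \<open>The group of pairs\<close>

lemma carrier_GG:
  "(u, g0) \<in> carrier (GG G l \<Delta>) \<longleftrightarrow>
     u \<noteq> 0 \<and> g0 \<in> G \<and> (\<forall>g\<in>G. l g *s g0 = bracket g0 g + (u - 1) *s \<Delta> g)"
  by (simp add: GG_def semidirect_def)

lemma mult_GG [simp]: "(u, g) \<otimes>\<^bsub>GG G l \<Delta>\<^esub> (u', g') = (u * u', u' *s g + g')"
  by (simp add: GG_def semidirect_def)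

lemma one_GG [simp]: "\<one>\<^bsub>GG G l \<Delta>\<^esub> = (1, 0)"
  by (simp add: GG_def semidirect_def)

lemma group_GG:
  assumes G: "subspace G"
  shows "group (GG G l \<Delta>)"
proof (rule groupI)
  let ?M = "GG G l \<Delta>"
  show "p \<otimes>\<^bsub>?M\<^esub> q \<in> carrier ?M" if "p \<in> carrier ?M" "q \<in> carrier ?M" for p q
  proof -
    obtain u g0 v h0 where pq: "p = (u, g0)" "q = (v, h0)"
      by (meson surj_pair)
    \<comment> \<open>This is \<open>v\<close> times the condition on \<open>p\<close> plus the
      condition on \<open>q\<close>; the coefficients of \<open>\<Delta> g\<close> combine by v(u -
      1) + (v - 1) = uv - 1.\<close>
    have "l g *s (v *s g0 + h0) = bracket (v *s g0 + h0) g + (u * v - 1) *s \<Delta> g" if "g \<in> G" for g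
    proof -
      have "l g *s (v *s g0 + h0) = v *s (l g *s g0) + l g *s h0"
        by (simp add: scale_right_distrib mult.commute)
      also have "\<dots> = v *s (bracket g0 g + (u - 1) *s \<Delta> g) + (bracket h0 g + (v - 1) *s \<Delta> g)"
        using \<open>g \<in> G\<close> \<open>p \<in> _\<close> \<open>q \<in> _\<close> by (simp add: pq carrier_GG)
      also have "\<dots> = bracket (v *s g0 + h0) g + (u * v - 1) *s \<Delta> g"
        by (simp add: bracket_add_left bracket_scale_left scale_right_distrib
            scale_left_diff_distrib scale_right_diff_distrib mult.commute)
      finally show ?thesis .
    qed
    then show ?thesis
      using that by (auto simp: pq carrier_GG intro!: subspace_add[OF G] subspace_scale[OF G])
  qed
  show "\<one>\<^bsub>?M\<^esub> \<in> carrier ?M"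
    by (simp add: carrier_GG subspace_0[OF G])
  show "p \<otimes>\<^bsub>?M\<^esub> q \<otimes>\<^bsub>?M\<^esub> r = p \<otimes>\<^bsub>?M\<^esub> (q \<otimes>\<^bsub>?M\<^esub> r)" for p q r
    by (cases p; cases q; cases r)
      (simp add: scale_right_distrib mult.commute mult.left_commute add.assoc)
  show "\<one>\<^bsub>?M\<^esub> \<otimes>\<^bsub>?M\<^esub> p = p" for p
    by (cases p) simp
  show "\<exists>q\<in>carrier ?M. q \<otimes>\<^bsub>?M\<^esub> p = \<one>\<^bsub>?M\<^esub>" if "p \<in> carrier ?M" for p
  proof -
    obtain u g0 where p: "p = (u, g0)"
      by (meson surj_pair)
    then have u: "u \<noteq> 0"
      using that by (simp add: carrier_GG)
    \<comment> \<open>The candidate inverse solves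
      \<open>(v, h) * (u, g0) = (u v, u h + g0) = (1, 0)\<close>. Its condition is that of
      \<open>p\<close> multiplied by -1/u, because -(1/u)(u - 1) = 1/u - 1.\<close>
    have "l g *s (- (1 / u) *s g0) = bracket (- (1 / u) *s g0) g + (1 / u - 1) *s \<Delta> g"
      if "g \<in> G" for g
    proof -
      have "l g *s (- (1 / u) *s g0) = - (1 / u) *s (l g *s g0)"
        by (simp add: mult.commute)
      also have "\<dots> = - (1 / u) *s (bracket g0 g + (u - 1) *s \<Delta> g)"
        using \<open>g \<in> G\<close> \<open>p \<in> _\<close> by (simp add: p carrier_GG)
      also have "\<dots> = bracket (- (1 / u) *s g0) g + (1 / u - 1) *s \<Delta> g"
        using u by (simp add: bracket_scale_left scale_right_distrib
            scale_left_diff_distrib scale_right_diff_distrib)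
      finally show ?thesis .
    qed
    then have "(1 / u, - (1 / u) *s g0) \<in> carrier ?M"
      using that u unfolding p carrier_GG by (auto intro!: subspace_scale[OF G] subspace_neg[OF G])
    then show ?thesis
      by (rule bexI[rotated]) (use u in \<open>simp add: p\<close>)
  qed
qed

lemma metabelian_GG:
  assumes "subspace G"
  shows "metabelian (GG G l \<Delta>)"
proof -
  let ?K = "\<lparr>carrier = {u :: 'k. u \<noteq> 0}, monoid.mult = (*), one = 1\<rparr>"
  have K: "comm_group ?K"
  proof (rule comm_groupI)
    show "\<exists>b\<in>carrier ?K. b \<otimes>\<^bsub>?K\<^esub> a = \<one>\<^bsub>?K\<^esub>" if "a \<in> carrier ?K" for a
      using that by (auto intro!: exI[of _ "inverse a"])
  qed (auto simp: mult.commute)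
  have "fst \<in> hom (GG G l \<Delta>) ?K"
    by (auto simp: hom_def carrier_GG)
  then interpret group_hom "GG G l \<Delta>" ?K fst
    using K group_GG[OF assms]
    by (simp add: group_hom_def group_hom_axioms_def comm_group.axioms)
  show ?thesis
    \<comment> \<open>In the kernel both first components are 1, so the product reduces to addition
      of the second components.\<close>
    by (rule metabelian_if_kernel_commutes[OF K]) (auto simp: kernel_def add.commute)
qed

end

section \<open>Codimension one: decomposition and twisted derivation\<close>

locale codim_1_subalgebra = lie_algebra scale bracket
  for scale :: "'k :: field \<Rightarrow> 'h :: ab_group_add \<Rightarrow> 'h" (infixr "*s" 75)
    and bracket :: "'h \<Rightarrow> 'h \<Rightarrow> 'h" +
  fixes G :: "'h set" and x :: 'h and l :: "'h \<Rightarrow> 'k" and \<Delta> :: "'h \<Rightarrow> 'h"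
  assumes subalgebra: "lie_subalgebra G"
    and codim: "has_codim G 1"
    and x_notin: "x \<notin> G"
    and Delta_in: "\<Delta> \<in> G \<rightarrow> G"
    and bracket_x: "g \<in> G \<Longrightarrow> bracket x g = \<Delta> g + l g *s x"
begin

lemma subspace_G: "subspace G"
  and bracket_closed: "g \<in> G \<Longrightarrow> h \<in> G \<Longrightarrow> bracket g h \<in> G"
  using subalgebra by (auto simp: lie_subalgebra_def)

lemmas closed = subspace_0[OF subspace_G] subspace_add[OF subspace_G] subspace_scale[OF subspace_G]
  subspace_diff[OF subspace_G] bracket_closed funcset_mem[OF Delta_in]

lemma decomp:
  obtains g \<alpha> where "g \<in> G" "v = g + \<alpha> *s x"
  using codim_1_decomp[OF subspace_G codim x_notin, of v] by blast

lemma decomp_unique: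
  assumes "g \<in> G" "h \<in> G" and eq: "g + \<alpha> *s x = h + \<beta> *s x"
  shows "g = h \<and> \<alpha> = \<beta>"
proof -
  have "(\<alpha> - \<beta>) *s x = h - g"
    using eq by (simp add: scale_left_diff_distrib algebra_simps)
  then have "(\<alpha> - \<beta>) *s x \<in> G"
    using assms by (simp add: closed)
  \<comment> \<open>If the coefficients differed, dividing by their difference would put
    \<open>x\<close> into \<open>G\<close>.\<close>
  then have "inverse (\<alpha> - \<beta>) *s (\<alpha> - \<beta>) *s x \<in> G"
    by (rule closed)
  then have "\<alpha> = \<beta>"
    using x_notin by (cases "\<alpha> = \<beta>") auto
  then show ?thesis
    using eq by simp
qed

text \<open>Every law comes from expanding \<open>bracket x\<close> of a sum, a multiple or a
  bracket in two ways and comparing the component in \<open>G\<close> and the coefficient of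
  \<open>x\<close>.\<close>

lemma twisted_derivation: "twisted_derivation G l \<Delta>"
proof -
  have add: "\<Delta> (g + h) = \<Delta> g + \<Delta> h \<and> l (g + h) = l g + l h" if "g \<in> G" "h \<in> G" for g h
  proof (rule decomp_unique)
    show "\<Delta> (g + h) + l (g + h) *s x = \<Delta> g + \<Delta> h + (l g + l h) *s x"
      using bracket_x[of "g + h"] that
      by (simp add: closed bracket_add_right bracket_x scale_left_distrib algebra_simps)
  qed (use that in \<open>simp_all add: closed\<close>)
  have scale: "\<Delta> (r *s g) = r *s \<Delta> g \<and> l (r *s g) = r * l g" if "g \<in> G" for r g
  proof (rule decomp_unique)
    show "\<Delta> (r *s g) + l (r *s g) *s x = r *s \<Delta> g + (r * l g) *s x"
      using bracket_x[of "r *s g"] that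
      by (simp add: closed bracket_scale_right bracket_x scale_right_distrib)
  qed (use that in \<open>simp_all add: closed\<close>)
  have bracket: "\<Delta> (bracket g h) = bracket (\<Delta> g) h + bracket g (\<Delta> h) + l g *s \<Delta> h - l h *s \<Delta> g
      \<and> l (bracket g h) = 0" if g: "g \<in> G" and h: "h \<in> G" for g h
  proof (rule decomp_unique)
    have hx: "bracket h x = - bracket x h" and gx: "bracket g x = - bracket x g"
      by (rule bracket_anticomm)+
    \<comment> \<open>The Jacobi identity, which the next step turns into the statement that
      \<open>bracket x\<close> is a derivation.\<close>
    have "bracket x (bracket g h) = - bracket g (bracket h x) - bracket h (bracket x g)"
      using jacobi[of x g h] by (simp add: eq_neg_iff_add_eq_0 algebra_simps)
    also have "\<dots> = bracket g (bracket x h) + bracket (bracket x g) h"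
      using bracket_anticomm[of g "bracket h x"] bracket_anticomm[of "bracket x g" h]
        bracket_anticomm[of g "bracket x h"]
      by (simp add: hx)
    \<comment> \<open>The two multiples of \<open>x\<close> that arise, with coefficients
      \<open>l g * l h\<close> and \<open>- (l h * l g)\<close>, cancel. The summand
      \<open>0 *s x\<close> lets \<open>decomp_unique\<close> read off
      \<open>l (bracket g h) = 0\<close> as well.\<close>
    also have "\<dots> = bracket (\<Delta> g) h + bracket g (\<Delta> h) + l g *s \<Delta> h - l h *s \<Delta> g + 0 *s x"
      by (simp add: g h bracket_x bracket_add_left bracket_add_right bracket_scale_left
          bracket_scale_right gx scale_right_distrib mult.commute algebra_simps)
    finally show "\<Delta> (bracket g h) + l (bracket g h) *s x
        = bracket (\<Delta> g) h + bracket g (\<Delta> h) + l g *s \<Delta> h - l h *s \<Delta> g + 0 *s x"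
      by (simp add: bracket_x bracket_closed g h)
  qed (use that in \<open>simp_all add: closed\<close>)
  show ?thesis
    unfolding twisted_derivation_def using Delta_in add scale bracket by blast
qed

section \<open>The map from pairs to automorphisms\<close>

lemma Omega_eq:
  assumes "g \<in> G"
  shows "Omega G x (u, g0) (g + \<alpha> *s x) = g + \<alpha> *s g0 + (u * \<alpha>) *s x"
  unfolding Omega_def prod.case
  by (rule the_equality) (use assms decomp_unique in blast)+

lemma Omega_fixes: "g \<in> G \<Longrightarrow> Omega G x (u, g0) g = g"
  using Omega_eq[of g u g0 0] by simp

lemma Omega_x: "Omega G x (u, g0) x = g0 + u *s x"
  using Omega_eq[of 0 u g0 1] by (simp add: closed)

text \<open>The right factor acts first and sends g + \<alpha> x to (g + \<alpha> h0) + (v \<alpha>)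
  x. As \<open>h0\<close> lies in \<open>G\<close>, this is again a decomposition, to which
  \<open>Omega_eq\<close> applies with coefficient v \<alpha>; this produces the term
  \<open>v *s g0\<close> of the semidirect product.\<close>

lemma Omega_mult:
  assumes "h0 \<in> G"
  shows "Omega G x (u * v, v *s g0 + h0) = Omega G x (u, g0) \<circ> Omega G x (v, h0)"
proof
  fix w
  obtain g \<alpha> where g: "g \<in> G" and w: "w = g + \<alpha> *s x"
    by (rule decomp)
  show "Omega G x (u * v, v *s g0 + h0) w = (Omega G x (u, g0) \<circ> Omega G x (v, h0)) w"
    using assms g Omega_eq[of "g + \<alpha> *s h0" u g0 "v * \<alpha>"]
    by (simp add: w Omega_eq closed scale_right_distrib algebra_simps)
qed

lemma Omega_one: "Omega G x (1, 0) = id"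
proof
  show "Omega G x (1, 0) w = id w" for w
    by (rule decomp[of w]) (simp add: Omega_eq)
qed

lemma linear_Omega: "Vector_Spaces.linear scale scale (Omega G x (u, g0))"
  unfolding Vector_Spaces.linear_iff
proof (intro conjI allI)
  fix v w r
  obtain g \<alpha> h \<beta> where g: "g \<in> G" "v = g + \<alpha> *s x" and h: "h \<in> G" "w = h + \<beta> *s x"
    by (metis decomp)
  have "v + w = (g + h) + (\<alpha> + \<beta>) *s x"
    by (simp add: g h scale_left_distrib algebra_simps)
  then have "Omega G x (u, g0) (v + w) = (g + h) + (\<alpha> + \<beta>) *s g0 + (u * (\<alpha> + \<beta>)) *s x"
    using g(1) h(1) by (simp only: Omega_eq closed)
  then show "Omega G x (u, g0) (v + w) = Omega G x (u, g0) v + Omega G x (u, g0) w"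
    using g h by (simp add: Omega_eq scale_left_distrib distrib_left algebra_simps)
  have "r *s v = r *s g + (r * \<alpha>) *s x"
    by (simp add: g scale_right_distrib)
  then have "Omega G x (u, g0) (r *s v) = r *s g + (r * \<alpha>) *s g0 + (u * (r * \<alpha>)) *s x"
    using g(1) by (simp only: Omega_eq closed)
  then show "Omega G x (u, g0) (r *s v) = r *s Omega G x (u, g0) v"
    using g by (simp add: Omega_eq scale_right_distrib mult.left_commute)
qed (rule vector_space_axioms)+

text \<open>Bilinearity leaves four cases: brackets within \<open>G\<close> are fixed,
  \<open>[x, g]\<close> is the hypothesis, \<open>[g, x]\<close> follows by anticommutativity, and
  \<open>[x, x]\<close> vanishes on both sides.\<close>

lemma bracket_preserving:
  assumes \<sigma>: "Vector_Spaces.linear scale scale \<sigma>" and fixes_G: "\<And>g. g \<in> G \<Longrightarrow> \<sigma> g = g"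
    and x: "\<And>g. g \<in> G \<Longrightarrow> \<sigma> (bracket x g) = bracket (\<sigma> x) g"
  shows "\<sigma> (bracket v w) = bracket (\<sigma> v) (\<sigma> w)"
proof -
  interpret \<sigma>: Vector_Spaces.linear scale scale \<sigma> by (rule \<sigma>)
  obtain g \<alpha> h \<beta> where g: "g \<in> G" "v = g + \<alpha> *s x" and h: "h \<in> G" "w = h + \<beta> *s x"
    by (metis decomp)
  have gx: "bracket g x = - bracket x g" "bracket g (\<sigma> x) = - bracket (\<sigma> x) g"
    using bracket_anticomm by blast+
  show ?thesis
    by (simp add: g h bracket_add_left bracket_add_right bracket_scale_left bracket_scale_right
        bracket_self \<sigma>.add \<sigma>.scale \<sigma>.diff fixes_G bracket_closed x gx)
qed

text \<open>For a linear \<open>\<sigma>\<close> fixing \<open>G\<close> with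
  \<open>\<sigma> x = g0 + u *s x\<close>, the left equation says that
  \<open>\<sigma> [x, g] = [\<sigma> x, g]\<close>. The multiples of \<open>x\<close> on its two
  sides agree, so both equations have the same difference of sides.\<close>

lemma GG_condition_iff:
  assumes "g \<in> G"
  shows "\<Delta> g + l g *s (g0 + u *s x) = bracket (g0 + u *s x) g \<longleftrightarrow>
    l g *s g0 = bracket g0 g + (u - 1) *s \<Delta> g"
proof -
  have "\<Delta> g + l g *s (g0 + u *s x) - bracket (g0 + u *s x) g
      = l g *s g0 - (bracket g0 g + (u - 1) *s \<Delta> g)"
    by (simp add: assms bracket_x bracket_add_left bracket_scale_left scale_right_distrib
        scale_left_diff_distrib mult.commute)
  then show ?thesis
    by (metis right_minus_eq)
qed

lemma Omega_in_Gal: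
  assumes p: "p \<in> carrier (GG G l \<Delta>)"
  shows "Omega G x p \<in> carrier (Gal G)"
proof -
  interpret GG: group "GG G l \<Delta>" by (rule group_GG[OF subspace_G])
  obtain u g0 where p': "p = (u, g0)"
    by (meson surj_pair)
  obtain v h0 where q': "inv\<^bsub>GG G l \<Delta>\<^esub> p = (v, h0)"
    by (meson surj_pair)
  have mem: "g0 \<in> G" "h0 \<in> G"
    using GG.inv_closed[OF p] p by (simp_all add: p' q'[unfolded p'] carrier_GG)
  \<comment> \<open>Multiplicativity turns the inverse in \<open>GG\<close> into a two-sided inverse
    map, which gives bijectivity.\<close>
  have "Omega G x (v, h0) \<circ> Omega G x (u, g0) = id" "Omega G x (u, g0) \<circ> Omega G x (v, h0) = id"
    using GG.l_inv[OF p] GG.r_inv[OF p] mem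
    by (simp_all add: q'[unfolded p'] p' Omega_one flip: Omega_mult)
  then have bij: "bij (Omega G x (u, g0))"
    by (rule o_bij)
  have "Omega G x (u, g0) (bracket v w) = bracket (Omega G x (u, g0) v) (Omega G x (u, g0) w)" for v w
  proof (rule bracket_preserving[OF linear_Omega Omega_fixes])
    fix g assume g: "g \<in> G"
    have "Omega G x (u, g0) (bracket x g) = \<Delta> g + l g *s (g0 + u *s x)"
      using g by (simp add: bracket_x Omega_eq closed scale_right_distrib mult.commute add.assoc)
    then show "Omega G x (u, g0) (bracket x g) = bracket (Omega G x (u, g0) x) g"
      using p g GG_condition_iff[OF g] by (simp add: p' carrier_GG Omega_x)
  qed
  then show ?thesis
    by (simp add: p' carrier_Gal lie_automorphism_def linear_Omega bij Omega_fixes)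
qed

lemma Gal_eq_Omega:
  assumes "\<sigma> \<in> carrier (Gal G)"
  obtains p where "p \<in> carrier (GG G l \<Delta>)" "\<sigma> = Omega G x p"
proof -
  have "Vector_Spaces.linear scale scale \<sigma>" and "bij \<sigma>"
    and hom: "\<And>v w. \<sigma> (bracket v w) = bracket (\<sigma> v) (\<sigma> w)"
    and fixes_G: "\<And>g. g \<in> G \<Longrightarrow> \<sigma> g = g"
    using assms by (auto simp: carrier_Gal lie_automorphism_def)
  then interpret \<sigma>: Vector_Spaces.linear scale scale \<sigma> by simp
  obtain g0 u where g0: "g0 \<in> G" and \<sigma>x: "\<sigma> x = g0 + u *s x"
    by (rule decomp)
  have "u \<noteq> 0"
  proof
    assume "u = 0"
    \<comment> \<open>\<open>\<sigma>\<close> fixes \<open>g0\<close>, so injectivity would give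
      \<open>x = g0\<close>, an element of \<open>G\<close>.\<close>
    then have "\<sigma> x = \<sigma> g0"
      using g0 \<sigma>x fixes_G by simp
    then show False
      using \<open>bij \<sigma>\<close> g0 x_notin by (auto dest: bij_is_inj injD)
  qed
  moreover have "l g *s g0 = bracket g0 g + (u - 1) *s \<Delta> g" if g: "g \<in> G" for g
  proof -
    have "\<Delta> g + l g *s (g0 + u *s x) = \<sigma> (bracket x g)"
      using g by (simp add: bracket_x \<sigma>.add \<sigma>.scale fixes_G closed \<sigma>x)
    also have "\<dots> = bracket (g0 + u *s x) g"
      using g by (simp add: hom fixes_G \<sigma>x)
    finally show ?thesis
      using GG_condition_iff[OF g] by simp
  qed
  ultimately have "(u, g0) \<in> carrier (GG G l \<Delta>)"
    using g0 by (simp add: carrier_GG)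
  moreover have "\<sigma> w = Omega G x (u, g0) w" for w
    by (rule decomp[of w])
      (simp add: Omega_eq \<sigma>.add \<sigma>.scale fixes_G \<sigma>x scale_right_distrib mult.commute algebra_simps)
  ultimately show ?thesis
    using that by blast
qed

section \<open>The isomorphism and its consequences\<close>

lemma Omega_iso: "Omega G x \<in> iso (GG G l \<Delta>) (Gal G)"
proof (rule isoI)
  show "Omega G x \<in> hom (GG G l \<Delta>) (Gal G)"
    by (rule homI) (auto simp: Omega_in_Gal carrier_GG Omega_mult)
  \<comment> \<open>The value at \<open>x\<close> is \<open>g0 + u *s x\<close>, from which
    uniqueness of the decomposition recovers the pair.\<close>
  have "p = q" if "p \<in> carrier (GG G l \<Delta>)" "q \<in> carrier (GG G l \<Delta>)"
    and eq: "Omega G x p = Omega G x q" for p q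
    using that(1,2) fun_cong[OF eq, of x] decomp_unique
    by (cases p; cases q) (simp add: carrier_GG Omega_x, blast)
  then have "inj_on (Omega G x) (carrier (GG G l \<Delta>))"
    by (rule inj_onI)
  then show "bij_betw (Omega G x) (carrier (GG G l \<Delta>)) (carrier (Gal G))"
    by (auto simp: bij_betw_def Omega_in_Gal elim: Gal_eq_Omega)
qed

lemma group_Gal: "group (Gal G)"
  using group.iso_imp_group[OF group_GG[OF subspace_G] _ monoid_Gal] Omega_iso
  by (auto simp: is_iso_def)

lemma metabelian_Gal: "metabelian (Gal G)"
proof -
  interpret group_hom "GG G l \<Delta>" "Gal G" "Omega G x"
    using Omega_iso group_GG[OF subspace_G] group_Gal
    by (simp add: group_hom_def group_hom_axioms_def iso_def)
  show ?thesis
    using metabelian_surj_img[OF metabelian_GG[OF subspace_G]] Omega_iso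
    by (simp add: iso_def bij_betw_def)
qed

end

theorem corollary4p1:
  fixes scale :: "'k :: field \<Rightarrow> 'h :: ab_group_add \<Rightarrow> 'h"
    and bracket :: "'h \<Rightarrow> 'h \<Rightarrow> 'h"
    and G :: "'h set" and x :: 'h
    and l :: "'h \<Rightarrow> 'k" and \<Delta> :: "'h \<Rightarrow> 'h"
  assumes "lie_algebra scale bracket"
    and "lie_algebra.lie_subalgebra scale bracket G"
    and "vector_space.has_codim scale G 1"
    and "x \<notin> G"
    and "\<Delta> \<in> G \<rightarrow> G"
    and "\<And>g. g \<in> G \<Longrightarrow> bracket x g = \<Delta> g + scale (l g) x"
  defines "\<GG> \<equiv> lie_algebra.GG scale bracket G l \<Delta>"
    and "Galois \<equiv> lie_algebra.Gal scale bracket G"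
    and "\<Omega> \<equiv> lie_algebra.Omega scale G x"
  shows "lie_algebra.twisted_derivation scale bracket G l \<Delta>
    \<and> group \<GG> \<and> group Galois
    \<and> (\<forall>(u, g0) \<in> carrier \<GG>. \<forall>g\<in>G. \<forall>\<alpha>.
          \<Omega> (u, g0) (g + scale \<alpha> x) = g + scale \<alpha> g0 + scale (u * \<alpha>) x)
    \<and> \<Omega> \<in> iso \<GG> Galois
    \<and> metabelian Galois
    \<and> solvable Galois"
proof -
  interpret codim_1_subalgebra scale bracket G x l \<Delta>
    using assms(1-6) by (simp add: codim_1_subalgebra_def codim_1_subalgebra_axioms_def)
  have "\<forall>(u, g0)\<in>carrier \<GG>. \<forall>g\<in>G. \<forall>\<alpha>.
      \<Omega> (u, g0) (g + scale \<alpha> x) = g + scale \<alpha> g0 + scale (u * \<alpha>) x"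
    unfolding \<Omega>_def by (auto simp: Omega_eq)
  then show ?thesis
    unfolding \<GG>_def Galois_def \<Omega>_def
    using twisted_derivation group_GG[OF subspace_G] group_Gal Omega_iso metabelian_Gal
      metabelian_imp_solvable[OF metabelian_Gal]
    by blast
qed

end
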